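(* Let $\{P_n(x)\}_{n\ge 1}$ be the sequence defined in the context. If $n\ge3$ is odd, then $$(2x+n-2)P_n(x)=2(x+n-1)(x+n-2)P_{n-2}(x)+(4x+3n-4)\prod_{j=0}^{(n-3)/2}(x+j);$$ if $n\ge4$ is even, then $$(2x+n-1)P_n(x)=2(x+n-1)(x+n-2)P_{n-2}(x)+\tfrac12(4x+3n-4)\prod_{j=0}^{(n-4)/2}(x+j).$$
   Context: The sequence $\{P_n(x)\}_{n\ge1}$ of rational functions of $x$ is defined by $P_1=P_2=1$ and, for $n\ge 2$: if $n$ is odd, $4(2x+n)P_{n+1}(x)=2(x+n)P_n(x)+(2x+n)P_n(x+1)+(4x+n)\ell_n(x)$; if $n$ is even, $4P_{n+1}(x)=4(x+n)P_n(x)+2(2x+n+1)P_n(x+1)+(4x+n)\ell_{n-1}(x)$. Here for odd $r\ge1$, $\ell_r(x)=\prod_{j=1}^{(r-1)/2}(x+j)$ (the empty product equals $1$). *)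

theory Defs
  imports "HOL-Computational_Algebra.Computational_Algebra"
begin

type_synonym 'a ratfun = "'a poly fract"

definition ratX :: "'a::field_char_0 ratfun" where
  "ratX = to_fract [:0, 1:]"

text \<open>The substitution \<open>f(x) \<mapsto> f(x + 1)\<close>, applied to an arbitrary representing pair
  of numerator and nonzero denominator; independent of the representative by \<open>shift_Fract\<close>.\<close>

definition shift :: "'a::field_char_0 ratfun \<Rightarrow> 'a ratfun" where
  "shift f = (case rep_fract f of (p, q) \<Rightarrow> Fract (p \<circ>\<^sub>p [:1, 1:]) (q \<circ>\<^sub>p [:1, 1:]))"

lemma shift_Fract:
  fixes p q :: "'a::field_char_0 poly"
  assumes "q \<noteq> 0"
  shows "shift (Fract p q) = Fract (p \<circ>\<^sub>p [:1, 1:]) (q \<circ>\<^sub>p [:1, 1:])"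
proof -
  obtain p' q' where pq: "rep_fract (Fract p q) = (p', q')" by force
  have "Fract p q = abs_fract (p, q)"
    using assms by (simp add: Fract.abs_eq)
  then have "fractrel (p, q) (rep_fract (Fract p q))"
    using assms by (metis (no_types, lifting) Quotient_fract Quotient_rep_abs_eq fractrel_iff
        Quotient_symp sympD snd_conv Quotient_rep_abs)
  then have q': "q' \<noteq> 0" and eq: "p * q' = p' * q"
    by (auto simp: pq)
  have "(p \<circ>\<^sub>p [:1, 1:]) * (q' \<circ>\<^sub>p [:1, 1:]) = (p' \<circ>\<^sub>p [:1, 1:]) * (q \<circ>\<^sub>p [:1, 1:])"
    using eq by (simp flip: pcompose_mult)
  then show ?thesis
    using assms q' by (simp add: shift_def pq eq_fract pcompose_eq_0_iff)
qed

lemma shift_ratX: "shift ratX = ratX + 1"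
  by (simp add: ratX_def to_fract_def shift_Fract pcompose_pCons pcompose_1 One_fract_def one_pCons)

text \<open>Only used for odd \<open>r\<close>.\<close>

definition ell :: "nat \<Rightarrow> 'a::field_char_0 ratfun" where
  "ell r = (\<Prod>j = 1..(r - 1) div 2. ratX + of_nat j)"

text \<open>The sequence starts at index 1; the value at 0 is a dummy and is never used.
  The factors \<open>4(2x + n)\<close> and \<open>4\<close> of the recurrence are divided out here;
  \<open>P_rec_odd\<close> and \<open>P_rec_even\<close> below give it in its original form.\<close>

fun P :: "nat \<Rightarrow> 'a::field_char_0 ratfun" where
  "P 0 = 0"
| "P (Suc n) =
     (if n \<le> 1 then 1
      else if odd n then
        (2 * (ratX + of_nat n) * P n + (2 * ratX + of_nat n) * shift (P n)
           + (4 * ratX + of_nat n) * ell n) / (4 * (2 * ratX + of_nat n))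
      else
        (4 * (ratX + of_nat n) * P n + 2 * (2 * ratX + of_nat n + 1) * shift (P n)
           + (4 * ratX + of_nat n) * ell (n - 1)) / 4)"

lemma of_nat_ratfun: "(of_nat n :: 'a::field_char_0 ratfun) = to_fract (of_nat n)"
  by (induction n) simp_all

lemma four_ratfun_neq_0: "(4 :: 'a::field_char_0 ratfun) \<noteq> 0"
  using of_nat_ratfun[of 4, where 'a = 'a] by (metis of_nat_eq_0_iff of_nat_numeral
      to_fract_eq_0_iff zero_neq_numeral)

lemma two_ratX_plus_neq_0: "2 * ratX + of_nat n \<noteq> (0 :: 'a::field_char_0 ratfun)"
proof -
  have "2 * ratX + of_nat n = ratX + ratX + (of_nat n :: 'a ratfun)"
    by simp
  also have "\<dots> = to_fract [:of_nat n, 2:]"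
    unfolding ratX_def of_nat_ratfun to_fract_add [symmetric]
    by (simp add: of_nat_poly)
  finally show ?thesis by simp
qed

lemma P_1: "P 1 = 1" and P_2: "P 2 = 1"
  by (simp_all add: numeral_2_eq_2)

lemma P_rec_odd:
  assumes "n \<ge> 2" "odd n"
  shows "4 * (2 * ratX + of_nat n) * P (n + 1) =
    2 * (ratX + of_nat n) * P n + (2 * ratX + of_nat n) * shift (P n)
      + (4 * ratX + of_nat n) * (ell n :: 'a::field_char_0 ratfun)"
proof -
  have "4 * (2 * ratX + of_nat n) \<noteq> (0 :: 'a ratfun)"
    by (intro no_zero_divisors four_ratfun_neq_0 two_ratX_plus_neq_0)
  then show ?thesis
    using assms by (simp del: mult_eq_0_iff distrib_left_numeral)
qed

lemma P_rec_even:
  assumes "n \<ge> 2" "even n"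
  shows "4 * P (n + 1) =
    4 * (ratX + of_nat n) * P n + 2 * (2 * ratX + of_nat n + 1) * shift (P n)
      + (4 * ratX + of_nat n) * ell (n - 1)"
  using assms by (simp add: four_ratfun_neq_0)

end

theory Submission
  imports Defs
begin

text \<open>Induction on \<open>n\<close>: substituting the identity for \<open>P n\<close> and its image under \<open>x \<mapsto> x + 1\<close>
  into the recurrence for \<open>P (n + 1)\<close>, the terms in \<open>P (n - 2)\<close> and \<open>shift (P (n - 2))\<close>
  reassemble by the recurrence for \<open>P (n - 1)\<close> to \<open>2 (x + n) (x + n - 1) P (n - 1)\<close>.
  What remains is a polynomial identity times a product of linear factors.\<close>

lemma shift_to_fract: "shift (to_fract p) = to_fract (p \<circ>\<^sub>p [:1, 1:])"
  by (simp add: to_fract_def shift_Fract pcompose_1)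

text \<open>Composition with x + 1 keeps a nonzero denominator nonzero, so the formula for a sum of
  fractions survives the substitution. Together with \<open>shift_mult\<close> and
  \<open>shift_1\<close> this makes \<open>shift\<close> a ring endomorphism, so that a whole
  identity between the \<open>P n\<close> can be shifted.\<close>

lemma shift_add: "shift (f + g) = shift f + shift g"
proof (cases f, cases g)
  fix a b c d :: "'a poly"
  assume "f = Fract a b" "b \<noteq> 0" "g = Fract c d" "d \<noteq> 0"
  then show ?thesis
    by (simp add: shift_Fract pcompose_add pcompose_mult pcompose_eq_0_iff)
qed

lemma shift_mult: "shift (f * g) = shift f * shift g"
proof (cases f, cases g)
  fix a b c d :: "'a poly"
  assume "f = Fract a b" "b \<noteq> 0" "g = Fract c d" "d \<noteq> 0"
  then show ?thesis
    by (simp add: shift_Fract pcompose_mult)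
qed

lemma shift_of_nat: "shift (of_nat n) = of_nat n"
  by (simp add: of_nat_ratfun shift_to_fract of_nat_poly)

lemma shift_numeral: "shift (numeral n) = numeral n"
  using shift_of_nat [of "numeral n"] by simp

lemma shift_1: "shift 1 = 1"
  using shift_of_nat [of 1] by simp

lemmas shift_simps = shift_add shift_mult shift_of_nat shift_numeral shift_1 shift_ratX

lemma shift_prod: "shift (\<Prod>i\<in>A. f i) = (\<Prod>i\<in>A. shift (f i))"
  by (induction A rule: infinite_finite_induct) (simp_all add: shift_1 shift_mult)

lemma ell_Suc: "ell (2 * k + 3) = (ratX + of_nat k + 1) * ell (2 * k + 1)"
  by (simp add: ell_def add.assoc mult.commute add.commute)

text \<open>The products of the theorem start at j = 0 whereas \<open>ell\<close> starts at j = 1;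
  splitting off the factor \<open>ratX\<close> expresses every inhomogeneous term through
  \<open>ell\<close>.\<close>

lemma prod_ratX_plus: "(\<Prod>j = 0..k. ratX + of_nat j) = ratX * ell (2 * k + 1)"
  by (simp add: ell_def prod.atLeast_Suc_atMost)

text \<open>The substitution merely reindexes the product from 0..k to 1..k+1. By
  \<open>ell_Suc\<close> the result is again a polynomial multiple of
  \<open>ell (2 * k + 1)\<close>.\<close>

lemma shift_ratX_ell: "shift (ratX * ell (2 * k + 1)) = (ell (2 * k + 3) :: 'a::field_char_0 ratfun)"
proof -
  have "shift (ratX * ell (2 * k + 1)) = (\<Prod>j = 0..k. ratX + of_nat (Suc j) :: 'a ratfun)"
    unfolding prod_ratX_plus [symmetric] by (simp add: shift_prod shift_simps add.assoc add.left_commute)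
  also have "\<dots> = ell (2 * k + 3)"
    using prod.shift_bounds_cl_Suc_ivl [of "\<lambda>j. ratX + of_nat j :: 'a ratfun" 0 k]
    by (simp add: ell_def del: of_nat_Suc prod.cl_ivl_Suc)
  finally show ?thesis .
qed

text \<open>Unlike \<open>P_rec_odd\<close>, this includes \<open>n = 1\<close>.\<close>

lemma P_step_odd:
  fixes k :: nat
  defines "K \<equiv> of_nat k"
  shows "4 * (2 * ratX + 2 * K + 1) * P (2 * k + 2) =
    2 * (ratX + 2 * K + 1) * P (2 * k + 1) + (2 * ratX + 2 * K + 1) * shift (P (2 * k + 1))
      + (4 * ratX + 2 * K + 1) * (ell (2 * k + 1) :: 'a::field_char_0 ratfun)"
proof (cases k)
  \<comment> \<open>At n = 1 the value \<open>P 2\<close> is an initial value; with P 1 = P 2 = 1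
    both sides are 8x + 4.\<close>
  case 0
  then show ?thesis
    using P_1 P_2 by (simp add: K_def shift_1 ell_def numeral_2_eq_2 algebra_simps)
next
  case (Suc l)
  then show ?thesis
    using P_rec_odd [of "2 * k + 1", where 'a = 'a] by (simp add: K_def add.assoc del: P.simps)
qed

lemma P_step_even:
  fixes k :: nat
  defines "K \<equiv> of_nat k"
  shows "4 * P (2 * k + 3) =
    4 * (ratX + 2 * K + 2) * P (2 * k + 2) + 2 * (2 * ratX + 2 * K + 3) * shift (P (2 * k + 2))
      + (4 * ratX + 2 * K + 2) * (ell (2 * k + 1) :: 'a::field_char_0 ratfun)"
proof -
  have "2 * k + 2 + 1 = 2 * k + 3" "2 * k + 2 - 1 = 2 * k + 1"
    "of_nat (2 * k + 2) = 2 * K + 2" "2 * ratX + (2 * K + 2) + 1 = 2 * ratX + 2 * K + 3"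
    by (simp_all add: K_def)
  then show ?thesis
    using P_rec_even [of "2 * k + 2", where 'a = 'a] by (simp only: add.assoc) simp
qed

text \<open>The letters a, b, c, d stand for \<open>P (2 * k + 1)\<close> to
  \<open>P (2 * k + 4)\<close>, primes for shifts, and F for \<open>ell (2 * k + 1)\<close>. Here b
  and d are instances of the recurrence, c is the two-step identity for odd index and c' its shift.
  The factor \<open>4 * (2*x + 2*K + 1)\<close> stays on both sides, since a commutative ring need
  not allow cancellation.\<close>

lemma even_step_identity:
  fixes x K a a' b c c' d F :: "'a::comm_ring_1"
  assumes b: "4 * (2*x + 2*K + 1) * b = 2*(x + 2*K + 1)*a + (2*x + 2*K + 1)*a' + (4*x + 2*K + 1)*F"
    and c: "(2*x + 2*K + 1) * c = 2*(x + 2*K + 2)*(x + 2*K + 1)*a + (4*x + 6*K + 5)*(x*F)"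
    and c': "(2*x + 2*K + 3) * c' = 2*(x + 2*K + 3)*(x + 2*K + 2)*a' + (4*x + 6*K + 9)*((x + K + 1)*F)"
    and d: "4 * (2*x + 2*K + 3) * d = 2*(x + 2*K + 3)*c + (2*x + 2*K + 3)*c' + (4*x + 2*K + 3)*((x + K + 1)*F)"
  shows "4 * (2*x + 2*K + 1) * ((2*x + 2*K + 3) * d) =
    4 * (2*x + 2*K + 1) * (2*(x + 2*K + 3)*(x + 2*K + 2)*b + (2*x + 3*K + 4)*(x*F))"
proof -
  have "4 * (2*x + 2*K + 1) * ((2*x + 2*K + 3) * d) = (2*x + 2*K + 1) * (4 * (2*x + 2*K + 3) * d)"
    by (simp only: ac_simps)
  \<comment> \<open>The factor 2x + 2K + 1 completes c to the left side of its identity; the factor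
    2x + 2K + 3 required by c' is already present in d.\<close>
  also have "\<dots> = 2*(x + 2*K + 3)*((2*x + 2*K + 1)*c) + (2*x + 2*K + 1)*((2*x + 2*K + 3)*c')
      + (2*x + 2*K + 1)*((4*x + 2*K + 3)*((x + K + 1)*F))"
    unfolding d by (simp only: distrib_left ac_simps)
  \<comment> \<open>The terms in a and a' share the factor 2(x + 2K + 3)(x + 2K + 2), and their
    cofactor is the right side of b without its F term. The remaining coefficients of F agree as
    polynomials in x and K.\<close>
  also have "\<dots> = 2*(x + 2*K + 3)*(x + 2*K + 2) * (4 * (2*x + 2*K + 1) * b)
      + 4 * (2*x + 2*K + 1) * ((2*x + 3*K + 4)*(x*F))"
    unfolding b c c' by (simp add: algebra_simps)
  finally show ?thesis by (simp only: distrib_left ac_simps)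
qed

text \<open>The same elimination one index later: a, b, c, d stand for \<open>P (2 * k + 2)\<close>
  to \<open>P (2 * k + 5)\<close>, with F unchanged. The recurrence has no linear factor on its left
  side here, so only the constant 4 is left to cancel.\<close>

lemma odd_step_identity:
  fixes x K a a' b c c' d F :: "'a::comm_ring_1"
  assumes b: "4 * b = 4*(x + 2*K + 2)*a + 2*(2*x + 2*K + 3)*a' + (4*x + 2*K + 2)*F"
    and c: "(2*x + 2*K + 3) * c = 2*(x + 2*K + 3)*(x + 2*K + 2)*a + (2*x + 3*K + 4)*(x*F)"
    and c': "(2*x + 2*K + 5) * c' = 2*(x + 2*K + 4)*(x + 2*K + 3)*a' + (2*x + 3*K + 6)*((x + K + 1)*F)"
    and d: "4 * d = 4*(x + 2*K + 4)*c + 2*(2*x + 2*K + 5)*c' + (4*x + 2*K + 4)*((x + K + 1)*F)"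
  shows "4 * ((2*x + 2*K + 3) * d) =
    4 * (2*(x + 2*K + 4)*(x + 2*K + 3)*b + (4*x + 6*K + 11)*(x*((x + K + 1)*F)))"
proof -
  have "4 * ((2*x + 2*K + 3) * d) = (2*x + 2*K + 3) * (4 * d)"
    by (simp only: ac_simps)
  also have "\<dots> = 4*(x + 2*K + 4)*((2*x + 2*K + 3)*c) + 2*(2*x + 2*K + 3)*((2*x + 2*K + 5)*c')
      + (2*x + 2*K + 3)*((4*x + 2*K + 4)*((x + K + 1)*F))"
    unfolding d by (simp only: distrib_left ac_simps)
  also have "\<dots> = 2*(x + 2*K + 4)*(x + 2*K + 3) * (4 * b)
      + 4 * ((4*x + 6*K + 11)*(x*((x + K + 1)*F)))"
    unfolding b c c' by (simp add: algebra_simps)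
  finally show ?thesis by (simp only: distrib_left ac_simps)
qed

lemma P_two_step_even:
  fixes k :: nat
  defines "K \<equiv> of_nat k"
  assumes odd: "(2 * ratX + 2 * K + 1) * P (2 * k + 3) =
    2 * (ratX + 2 * K + 2) * (ratX + 2 * K + 1) * P (2 * k + 1)
      + (4 * ratX + 6 * K + 5) * (ratX * (ell (2 * k + 1) :: 'a::field_char_0 ratfun))"
  shows "(2 * ratX + 2 * K + 3) * P (2 * k + 4) =
    2 * (ratX + 2 * K + 3) * (ratX + 2 * K + 2) * P (2 * k + 2)
      + (2 * ratX + 3 * K + 4) * (ratX * (ell (2 * k + 1) :: 'a ratfun))"
proof -
  \<comment> \<open>The product rule is first restricted to \<open>ratX * _\<close> on the right, so
    that \<open>ratX * ell (2 * k + 1)\<close> stays together and is shifted as a block by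
    \<open>shift_ratX_ell\<close>.\<close>
  have S: "(2 * ratX + 2 * K + 3) * shift (P (2 * k + 3)) =
    2 * (ratX + 2 * K + 3) * (ratX + 2 * K + 2) * shift (P (2 * k + 1))
      + (4 * ratX + 6 * K + 9) * ((ratX + K + 1) * (ell (2 * k + 1) :: 'a ratfun))"
    using arg_cong [OF odd, of shift]
    unfolding shift_add shift_mult [of _ "ratX * _"] shift_ratX_ell ell_Suc
    by (simp add: K_def shift_simps algebra_simps)
  have R: "4 * (2 * ratX + 2 * K + 3) * P (2 * k + 4) =
    2 * (ratX + 2 * K + 3) * P (2 * k + 3) + (2 * ratX + 2 * K + 3) * shift (P (2 * k + 3))
      + (4 * ratX + 2 * K + 3) * ((ratX + K + 1) * (ell (2 * k + 1) :: 'a ratfun))"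
  proof -
    have "2 * Suc k + 1 = 2 * k + 3" "2 * Suc k + 2 = 2 * k + 4"
      "2 * of_nat (Suc k) = 2 * K + (2 :: 'a ratfun)"
      by (simp_all add: K_def)
    then show ?thesis
      using P_step_odd [of "Suc k", where 'a = 'a]
      by (simp only: ell_Suc) (simp add: K_def add.assoc del: P.simps)
  qed
  \<comment> \<open>This is the factor common to both sides of \<open>even_step_identity\<close>; in
    the field of rational functions it can be cancelled.\<close>
  have "4 * (2 * ratX + 2 * K + 1) \<noteq> (0 :: 'a ratfun)"
    using two_ratX_plus_neq_0 [of "2 * k + 1", where 'a = 'a] four_ratfun_neq_0 [where 'a = 'a]
    unfolding K_def by (intro no_zero_divisors) (simp_all add: ac_simps)
  then show ?thesis
    using even_step_identity [OF P_step_odd [of k, where 'a = 'a, folded K_def] odd S R] mult_left_cancel by blast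
qed

text \<open>The conclusion is the odd identity at \<open>Suc k\<close>, which closes the cycle from
  odd to even and back to odd.\<close>

lemma P_two_step_odd:
  fixes k :: nat
  defines "K \<equiv> of_nat k"
  assumes even: "(2 * ratX + 2 * K + 3) * P (2 * k + 4) =
    2 * (ratX + 2 * K + 3) * (ratX + 2 * K + 2) * P (2 * k + 2)
      + (2 * ratX + 3 * K + 4) * (ratX * (ell (2 * k + 1) :: 'a::field_char_0 ratfun))"
  shows "(2 * ratX + 2 * K + 3) * P (2 * k + 5) =
    2 * (ratX + 2 * K + 4) * (ratX + 2 * K + 3) * P (2 * k + 3)
      + (4 * ratX + 6 * K + 11) * (ratX * (ell (2 * k + 3) :: 'a ratfun))"
proof -
  have S: "(2 * ratX + 2 * K + 5) * shift (P (2 * k + 4)) =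
    2 * (ratX + 2 * K + 4) * (ratX + 2 * K + 3) * shift (P (2 * k + 2))
      + (2 * ratX + 3 * K + 6) * ((ratX + K + 1) * (ell (2 * k + 1) :: 'a ratfun))"
    using arg_cong [OF even, of shift]
    unfolding shift_add shift_mult [of _ "ratX * _"] shift_ratX_ell ell_Suc
    by (simp add: K_def shift_simps algebra_simps)
  have R: "4 * P (2 * k + 5) =
    4 * (ratX + 2 * K + 4) * P (2 * k + 4) + 2 * (2 * ratX + 2 * K + 5) * shift (P (2 * k + 4))
      + (4 * ratX + 2 * K + 4) * ((ratX + K + 1) * (ell (2 * k + 1) :: 'a ratfun))"
  proof -
    have "2 * Suc k + 1 = 2 * k + 3" "2 * Suc k + 2 = 2 * k + 4" "2 * Suc k + 3 = 2 * k + 5"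
      "2 * of_nat (Suc k) = 2 * K + (2 :: 'a ratfun)"
      by (simp_all add: K_def)
    then show ?thesis
      using P_step_even [of "Suc k", where 'a = 'a]
      by (simp only: ell_Suc) (simp add: K_def add.assoc del: P.simps)
  qed
  show ?thesis
    using odd_step_identity [OF P_step_even [of k, where 'a = 'a, folded K_def] even S R]
    unfolding ell_Suc K_def using mult_left_cancel [OF four_ratfun_neq_0] by blast
qed

text \<open>The induction runs over the odd identity alone, each step passing through the even one;
  the even identity then follows for the same k.\<close>

lemma P_two_step:
  fixes k :: nat
  defines "K \<equiv> of_nat k"
  shows P_two_step_3: "(2 * ratX + 2 * K + 1) * P (2 * k + 3) =
    2 * (ratX + 2 * K + 2) * (ratX + 2 * K + 1) * P (2 * k + 1)
      + (4 * ratX + 6 * K + 5) * (ratX * (ell (2 * k + 1) :: 'a::field_char_0 ratfun))" (is ?odd)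
    and P_two_step_4: "(2 * ratX + 2 * K + 3) * P (2 * k + 4) =
    2 * (ratX + 2 * K + 3) * (ratX + 2 * K + 2) * P (2 * k + 2)
      + (2 * ratX + 3 * K + 4) * (ratX * (ell (2 * k + 1) :: 'a ratfun))" (is ?even)
proof -
  show ?odd
    unfolding K_def
  proof (induction k)
    case 0
    \<comment> \<open>The recurrence at n = 2 gives 4(x + 2) + 2(2x + 3) + (4x + 2) = 12x +
      16.\<close>
    have "4 * P 3 = 4 * (3 * ratX + 4 :: 'a ratfun)"
      using P_step_even [of 0, where 'a = 'a] P_2 [where ?'b = 'a]
      by (simp add: ell_def shift_1 algebra_simps del: P.simps flip: numeral_2_eq_2)
    then have "P 3 = (3 * ratX + 4 :: 'a ratfun)"
      using mult_left_cancel [OF four_ratfun_neq_0] by blast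
    then show ?case
      using P_1 [where 'a = 'a] by (simp add: ell_def algebra_simps del: P.simps)
  next
    case (Suc k)
    have "2 * Suc k + 3 = 2 * k + 5" "2 * Suc k + 1 = 2 * k + 3"
      by simp_all
    with P_two_step_odd [OF P_two_step_even [OF Suc.IH]] show ?case
      by (simp only:) (simp add: algebra_simps del: P.simps)
  qed
  then show ?even
    unfolding K_def by (rule P_two_step_even)
qed

theorem theorem5:
  fixes n :: nat
  shows "(n \<ge> 3 \<and> odd n \<longrightarrow>
      (2 * ratX + of_nat n - 2) * (P n :: 'a::field_char_0 ratfun) =
        2 * (ratX + of_nat n - 1) * (ratX + of_nat n - 2) * P (n - 2)
        + (4 * ratX + 3 * of_nat n - 4) * (\<Prod>j = 0..(n - 3) div 2. ratX + of_nat j))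
    \<and> (n \<ge> 4 \<and> even n \<longrightarrow>
      (2 * ratX + of_nat n - 1) * (P n :: 'a::field_char_0 ratfun) =
        2 * (ratX + of_nat n - 1) * (ratX + of_nat n - 2) * P (n - 2)
        + 1 / 2 * (4 * ratX + 3 * of_nat n - 4)
          * (\<Prod>j = 0..(n - 4) div 2. ratX + of_nat j))"
proof (intro conjI impI)
  assume "n \<ge> 3 \<and> odd n"
  then obtain k where n: "n = 2 * k + 3"
    by (metis add.commute le_Suc_ex odd_add odd_numeral evenE numeral_3_eq_3 odd_Suc_minus_one)
  have eqs: "n - 2 = 2 * k + 1" "(n - 3) div 2 = k"
    "2 * ratX + of_nat n - 2 = 2 * ratX + 2 * of_nat k + (1 :: 'a ratfun)"
    "ratX + of_nat n - 1 = ratX + 2 * of_nat k + (2 :: 'a ratfun)"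
    "ratX + of_nat n - 2 = ratX + 2 * of_nat k + (1 :: 'a ratfun)"
    "4 * ratX + 3 * of_nat n - 4 = 4 * ratX + 6 * of_nat k + (5 :: 'a ratfun)"
    by (simp_all add: n algebra_simps)
  show "(2 * ratX + of_nat n - 2) * (P n :: 'a ratfun) =
        2 * (ratX + of_nat n - 1) * (ratX + of_nat n - 2) * P (n - 2)
        + (4 * ratX + 3 * of_nat n - 4) * (\<Prod>j = 0..(n - 3) div 2. ratX + of_nat j)"
    unfolding eqs prod_ratX_plus using P_two_step_3 [of k, where 'a = 'a] by (simp only: n)
next
  assume "n \<ge> 4 \<and> even n"
  then obtain k where n: "n = 2 * k + 4"
    by (metis add.commute le_Suc_ex even_add even_numeral evenE)
  have two: "(2 :: 'a ratfun) \<noteq> 0"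
    using four_ratfun_neq_0 [where 'a = 'a] by (metis mult_2 add_0 numeral_Bit0)
  \<comment> \<open>Substituting n = 2k + 4 makes a factor 2 appear, which absorbs the 1/2 of the
    statement and leaves the coefficient of \<open>P_two_step_4\<close>.\<close>
  have "4 * ratX + 3 * of_nat n - 4 = 2 * (2 * ratX + 3 * of_nat k + (4 :: 'a ratfun))"
    by (simp add: n algebra_simps)
  then have half: "1 / 2 * (4 * ratX + 3 * of_nat n - 4) = 2 * ratX + 3 * of_nat k + (4 :: 'a ratfun)"
    using two by simp
  have eqs: "n - 2 = 2 * k + 2" "(n - 4) div 2 = k"
    "2 * ratX + of_nat n - 1 = 2 * ratX + 2 * of_nat k + (3 :: 'a ratfun)"
    "ratX + of_nat n - 1 = ratX + 2 * of_nat k + (3 :: 'a ratfun)"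
    "ratX + of_nat n - 2 = ratX + 2 * of_nat k + (2 :: 'a ratfun)"
    by (simp_all add: n algebra_simps)
  show "(2 * ratX + of_nat n - 1) * (P n :: 'a ratfun) =
        2 * (ratX + of_nat n - 1) * (ratX + of_nat n - 2) * P (n - 2)
        + 1 / 2 * (4 * ratX + 3 * of_nat n - 4)
          * (\<Prod>j = 0..(n - 4) div 2. ratX + of_nat j)"
    unfolding half eqs prod_ratX_plus using P_two_step_4 [of k, where 'a = 'a] by (simp only: n)
qed

end
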